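(* Fix an integer $d\ge3$ and let $f\colon V(\mathbb{T}_d)\to\mathbb{R}_{\ge0}$ be a non-negative function on the vertices of the $d$-regular tree $\mathbb{T}_d$ with root $o$, not identically zero, with $\alpha(f)<\infty$. Let $\mathbb{T}_d^{\mathrm{even}}$ (respectively $\mathbb{T}_d^{\mathrm{odd}}$) denote the set of vertices of $\mathbb{T}_d$ at even (respectively odd) distance from $o$. Then: (1) $\beta(f)=g_d(\alpha(f))$. (2) The same formula holds for ordinary limits: (a) If $\tilde\alpha(f)=\lim_{t\to\infty}a_t(f)^{1/t}$ exists and neither $f|_{\mathbb{T}_d^{\mathrm{even}}}$ nor $f|_{\mathbb{T}_d^{\mathrm{odd}}}$ is identically zero, then $\tilde\beta(f)=\lim_{t\to\infty}b_t(f)^{1/t}$ exists and $\tilde\beta(f)=g_d(\tilde\alpha(f))$. (b) If $\tilde\alpha^{\mathrm{even}}(f)=\lim_{t\to\infty}a_{2t}(f)^{1/(2t)}$ exists and $f|_{\mathbb{T}_d^{\mathrm{even}}}$ is not identically zero, then $\tilde\beta^{\mathrm{even}}(f)=\lim_{t\to\infty}b_{2t}(f)^{1/(2t)}$ exists and $\tilde\beta^{\mathrm{even}}(f)=g_d(\tilde\alpha^{\mathrm{even}}(f))$. (c) If $\tilde\alpha^{\mathrm{odd}}(f)=\lim_{t\to\infty}a_{2t+1}(f)^{1/(2t+1)}$ exists and $f|_{\mathbb{T}_d^{\mathrm{odd}}}$ is not identically zero, then $\tilde\beta^{\mathrm{odd}}(f)=\lim_{t\to\infty}b_{2t+1}(f)^{1/(2t+1)}$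 exists and $\tilde\beta^{\mathrm{odd}}(f)=g_d(\tilde\alpha^{\mathrm{odd}}(f))$.
   Context: $\mathbb{T}_d$ is the (infinite) $d$-regular tree with a fixed root vertex $o$. For $f\colon V(\mathbb{T}_d)\to\mathbb{R}_{\ge0}$, $a_t(f)=\sum_p f(\mathrm{end}(p))$, the sum over all non-backtracking walks $p$ of length $t$ in $\mathbb{T}_d$ starting at $o$, where $\mathrm{end}(p)$ is the last vertex of $p$; $b_t(f)=\sum_p f(\mathrm{end}(p))$, the sum over all (not necessarily non-backtracking) walks $p$ of length $t$ starting at $o$. Set $\alpha(f)=\limsup_{t\to\infty}a_t(f)^{1/t}$ and $\beta(f)=\limsup_{t\to\infty}b_t(f)^{1/t}$ (values in $[0,\infty]$). The map $g_d\colon\mathbb{R}_{\ge0}\to[2\sqrt{d-1},\infty)$ is defined by $g_d(\alpha)=2\sqrt{d-1}$ if $\alpha\le\sqrt{d-1}$, and $g_d(\alpha)=\alpha+\frac{d-1}{\alpha}$ if $\alpha\ge\sqrt{d-1}$. *)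

theory Defs
  imports Complex_Main "HOL-Library.Extended_Real" "Graph_Theory.Graph_Theory"
begin

text \<open>
  An undirected simple graph is a symmetric digraph without loops and parallel arcs, so that a
  walk is determined by its list of vertices.  The notions \<open>cycle\<close>, \<open>forest\<close> and \<open>tree\<close> of
  \<open>Graph_Theory\<close> are about digraphs: \<open>u, v, u\<close> is a cycle there.  In an undirected simple graph
  a cycle has at least three edges.
\<close>

definition undirected_cycle :: "('a, 'b) pre_digraph \<Rightarrow> 'a list \<Rightarrow> bool" where
  "undirected_cycle G p \<longleftrightarrow>
     vwalk p G \<and> hd p = last p \<and> distinct (tl p) \<and> vwalk_length p \<ge> 3"

text \<open>
  There is no finiteness assumption.  For \<open>d > 0\<close> the degree condition includes that every
  vertex has finitely many neighbours, since the cardinality of an infinite set is \<open>0\<close>.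
\<close>

locale regular_tree = sym_digraph G + loopfree_digraph G + nomulti_digraph G
  for d :: nat and G :: "('a, 'b) pre_digraph" +
  assumes connected: "strongly_connected G"
    and acyclic: "\<nexists>p. undirected_cycle G p"
    and regular: "\<And>v. v \<in> verts G \<Longrightarrow> out_degree G v = d"

definition graph_dist :: "('a, 'b) pre_digraph \<Rightarrow> 'a \<Rightarrow> 'a \<Rightarrow> nat" where
  "graph_dist G u v = (LEAST n. \<exists>p. vwalk p G \<and> hd p = u \<and> last p = v \<and> vwalk_length p = n)"

definition even_verts :: "('a, 'b) pre_digraph \<Rightarrow> 'a \<Rightarrow> 'a set" where
  "even_verts G r = {v \<in> verts G. even (graph_dist G r v)}"

definition odd_verts :: "('a, 'b) pre_digraph \<Rightarrow> 'a \<Rightarrow> 'a set" where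
  "odd_verts G r = {v \<in> verts G. odd (graph_dist G r v)}"

definition walks_from :: "('a, 'b) pre_digraph \<Rightarrow> 'a \<Rightarrow> nat \<Rightarrow> 'a list set" where
  "walks_from G r t = {p. vwalk p G \<and> hd p = r \<and> vwalk_length p = t}"

definition non_backtracking :: "'a list \<Rightarrow> bool" where
  "non_backtracking p \<longleftrightarrow> (\<forall>i. i + 2 < length p \<longrightarrow> p ! i \<noteq> p ! (i + 2))"

definition nb_walk_sum :: "('a, 'b) pre_digraph \<Rightarrow> 'a \<Rightarrow> ('a \<Rightarrow> real) \<Rightarrow> nat \<Rightarrow> real" where
  "nb_walk_sum G r f t = (\<Sum>p \<in> {p \<in> walks_from G r t. non_backtracking p}. f (last p))"

definition walk_sum :: "('a, 'b) pre_digraph \<Rightarrow> 'a \<Rightarrow> ('a \<Rightarrow> real) \<Rightarrow> nat \<Rightarrow> real" where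
  "walk_sum G r f t = (\<Sum>p \<in> walks_from G r t. f (last p))"

definition nb_growth :: "('a, 'b) pre_digraph \<Rightarrow> 'a \<Rightarrow> ('a \<Rightarrow> real) \<Rightarrow> ereal" where
  "nb_growth G r f = limsup (\<lambda>t. ereal (root t (nb_walk_sum G r f t)))"

definition walk_growth :: "('a, 'b) pre_digraph \<Rightarrow> 'a \<Rightarrow> ('a \<Rightarrow> real) \<Rightarrow> ereal" where
  "walk_growth G r f = limsup (\<lambda>t. ereal (root t (walk_sum G r f t)))"

text \<open>Only the values at \<open>x \<ge> 0\<close> are meaningful.\<close>

definition g_fun :: "nat \<Rightarrow> real \<Rightarrow> real" where
  "g_fun d x = (if x \<le> sqrt (real d - 1) then 2 * sqrt (real d - 1) else x + (real d - 1) / x)"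

end

theory Submission
  imports Defs
begin

text \<open>
  Write \<open>q = d - 1\<close> and let \<open>W t k\<close> be the number of walks of length \<open>t\<close> in the tree from a
  vertex to a given vertex at distance \<open>k\<close>, so that \<open>b\<^sub>t = (\<Sum>k\<le>t. W t k * a\<^sub>k)\<close>. The adjacency
  operator acts on the spherical sums by \<open>a\<^sub>k \<mapsto> a\<^bsub>k+1\<^esub> + q * a\<^bsub>k-1\<^esub>\<close> for \<open>k \<ge> 2\<close>.

  Upper bound: for \<open>x > sqrt q\<close> and \<open>y = q / x\<close> this action has an eigensequence of eigenvalue
  \<open>x + y\<close> comparable to \<open>x\<^sup>k\<close>, so \<open>a\<^sub>k \<le> M * x\<^sup>k\<close> implies \<open>b\<^sub>t \<le> M * (x + y)\<^sup>t\<close>.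

  Lower bound: by the ballot theorem \<open>W t (t - 2j)\<close> is at least \<open>q\<^sup>j * (t choose j) / (t + 1)\<close>. If
  \<open>a\<^sub>k \<ge> x\<^sup>k\<close> for \<open>k = t - 2j\<close>, then \<open>q = x * y\<close> turns this single term of \<open>b\<^sub>t\<close> into the \<open>j\<close>-th term of
  the binomial expansion of \<open>(x + y)\<^sup>t\<close>, up to the factor \<open>t + 1\<close>; taking \<open>j\<close> to be the mode gives
  \<open>b\<^sub>t \<ge> (x + y)\<^sup>t / (t + 1)\<^sup>2\<close>. As \<open>t\<close> grows by one, \<open>k\<close> changes by one, so every level \<open>k\<close>
  is reached. The value \<open>2 * sqrt q\<close> comes from the closed walks alone.
\<close>

section \<open>Spherical sums\<close>

text \<open>First-step recursion for \<open>W t k\<close> in the tree of degree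
  \<open>Suc q\<close>: away from the target one neighbour is nearer and \<open>q\<close> are
  farther, at the target all \<open>Suc q\<close> are farther.\<close>

fun walk_count :: "nat \<Rightarrow> nat \<Rightarrow> nat \<Rightarrow> nat" where
  "walk_count q 0 k = (if k = 0 then 1 else 0)"
| "walk_count q (Suc t) 0 = Suc q * walk_count q t 1"
| "walk_count q (Suc t) (Suc k) = walk_count q t k + q * walk_count q t (Suc (Suc k))"

text \<open>The spherical sums of all neighbours of a vertex, added up, in terms of those of the
  vertex itself. The factor at \<open>k = 1\<close> is \<open>Suc q\<close> because the vertex lies
  on the unit sphere of every neighbour.\<close>

definition radial_step :: "nat \<Rightarrow> (nat \<Rightarrow> real) \<Rightarrow> nat \<Rightarrow> real" where
  "radial_step q a k = a (Suc k) + (if k = 0 then 0 else if k = 1 then real (Suc q) * a 0 else real q * a (k - 1))"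

definition walk_transform :: "nat \<Rightarrow> (nat \<Rightarrow> real) \<Rightarrow> nat \<Rightarrow> real" where
  "walk_transform q a t = (\<Sum>k\<le>t. real (walk_count q t k) * a k)"

lemma walk_count_eq_0: "t < k \<Longrightarrow> walk_count q t k = 0"
  by (induction q t k rule: walk_count.induct) auto

lemma walk_count_parity: "even t \<noteq> even k \<Longrightarrow> walk_count q t k = 0"
  by (induction q t k rule: walk_count.induct) (auto intro: odd_pos)

text \<open>The radial step is the transpose of the recursion of \<open>walk_count\<close>.\<close>

lemma walk_transform_Suc: "walk_transform q a (Suc t) = walk_transform q (radial_step q a) t"
proof -
  define c where "c k = (if k = 0 then 0 else if k = 1 then real (Suc q) * a 0 else real q * a (k - 1))" for k :: nat
  \<comment> \<open>The added terms are zero; the longer range lets \<open>k = 0\<close> and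
    \<open>k = 1\<close> be split off, which leaves a shift by two.\<close>
  have "(\<Sum>k\<le>t. real (walk_count q t k) * c k) = (\<Sum>k\<le>Suc (Suc t). real (walk_count q t k) * c k)"
    by (simp add: walk_count_eq_0)
  also have "\<dots> = real (Suc q) * real (walk_count q t 1) * a 0
      + (\<Sum>k\<le>t. real q * real (walk_count q t (Suc (Suc k))) * a (Suc k))"
    unfolding sum.atMost_Suc_shift by (simp add: c_def mult_ac)
  finally have c: "(\<Sum>k\<le>t. real (walk_count q t k) * c k) = \<dots>" .
  have "walk_transform q (radial_step q a) t
      = (\<Sum>k\<le>t. real (walk_count q t k) * a (Suc k)) + (\<Sum>k\<le>t. real (walk_count q t k) * c k)"
    unfolding walk_transform_def radial_step_def c_def by (simp add: distrib_left sum.distrib)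
  also have "\<dots> = walk_transform q a (Suc t)"
    unfolding c walk_transform_def sum.atMost_Suc_shift
    by (simp add: distrib_right sum.distrib)
  finally show ?thesis ..
qed

text \<open>\<open>walk_count q t k\<close> vanishes for \<open>k\<close> of the wrong parity. This
  is what lets even and odd levels be treated separately.\<close>

lemma walk_transform_mono:
  assumes "\<And>k. even k = even t \<Longrightarrow> a k \<le> b k"
  shows "walk_transform q a t \<le> walk_transform q b t"
  unfolding walk_transform_def
proof (rule sum_mono)
  fix k
  show "real (walk_count q t k) * a k \<le> real (walk_count q t k) * b k"
    using assms[of k] walk_count_parity[of t k q]
    by (cases "even k = even t") (auto intro: mult_left_mono)
qed

lemma walk_transform_sum:
  "walk_transform q (\<lambda>k. \<Sum>w\<in>A. g w k) t = (\<Sum>w\<in>A. walk_transform q (g w) t)"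
  unfolding walk_transform_def sum_distrib_left by (rule sum.swap)

section \<open>Walks split at the first step\<close>

lemma non_backtracking_Cons:
  "non_backtracking (v # p) \<longleftrightarrow> non_backtracking p \<and> (2 \<le> length p \<longrightarrow> p ! 1 \<noteq> v)"
proof
  assume h: "non_backtracking (v # p)"
  have "p ! i \<noteq> p ! (i + 2)" if "i + 2 < length p" for i
    using h[unfolded non_backtracking_def, rule_format, of "Suc i"] that by simp
  moreover have "p ! 1 \<noteq> v" if "2 \<le> length p"
    using h[unfolded non_backtracking_def, rule_format, of 0] that by auto
  ultimately show "non_backtracking p \<and> (2 \<le> length p \<longrightarrow> p ! 1 \<noteq> v)"
    by (simp add: non_backtracking_def)
next
  assume h: "non_backtracking p \<and> (2 \<le> length p \<longrightarrow> p ! 1 \<noteq> v)"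
  have "(v # p) ! i \<noteq> (v # p) ! (i + 2)" if "i + 2 < length (v # p)" for i
    using h that by (cases i) (auto simp: non_backtracking_def)
  then show "non_backtracking (v # p)"
    by (simp add: non_backtracking_def)
qed

context regular_tree
begin

definition nbrs :: "'a \<Rightarrow> 'a set" where
  "nbrs v = {w. (v, w) \<in> arcs_ends G}"

lemma nbrs_sym: "w \<in> nbrs v \<longleftrightarrow> v \<in> nbrs w"
  using arcs_ends_symmetric[OF sym_arcs] by (auto simp: nbrs_def)

lemma nbrs_in_verts: "w \<in> nbrs v \<Longrightarrow> w \<in> verts G"
  by (auto simp: nbrs_def adj_in_verts)

lemma card_nbrs:
  assumes "v \<in> verts G"
  shows "card (nbrs v) = d"
proof -
  have "nbrs v = head G ` out_arcs G v"
    by (auto simp: nbrs_def arcs_ends_conv out_arcs_def)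
  moreover have "inj_on (head G) (out_arcs G v)"
    by (rule inj_onI) (auto intro!: no_multi_arcs simp: arc_to_ends_def)
  ultimately show ?thesis
    using regular[OF assms] by (simp add: card_image out_degree_def)
qed

lemma finite_nbrs: "d > 0 \<Longrightarrow> v \<in> verts G \<Longrightarrow> finite (nbrs v)"
  using card_nbrs card_ge_0_finite by metis

lemma walks_from_0: "v \<in> verts G \<Longrightarrow> walks_from G v 0 = {[v]}"
proof -
  have "vwalk p G \<and> hd p = v \<and> vwalk_length p = 0 \<longleftrightarrow> p = [v]" if "v \<in> verts G" for p
    using that by (cases p; cases "tl p") (auto simp: vwalk_def)
  then show "v \<in> verts G \<Longrightarrow> ?thesis" by (auto simp: walks_from_def)
qed

lemma walks_from_Suc:
  assumes "v \<in> verts G"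
  shows "walks_from G v (Suc t) = (\<Union>w\<in>nbrs v. (#) v ` walks_from G w t)"
proof (intro equalityI subsetI)
  fix p assume p: "p \<in> walks_from G v (Suc t)"
  then obtain p' where p': "p = v # p'" "length p' = Suc t" "vwalk p G"
    by (cases p) (auto simp: walks_from_def vwalk_def)
  then have "(v, hd p') \<in> arcs_ends G" "vwalk p' G"
    by (auto elim!: vwalk_consE)
  with p' show "p \<in> (\<Union>w\<in>nbrs v. (#) v ` walks_from G w t)"
    by (auto simp: walks_from_def nbrs_def)
next
  fix p assume "p \<in> (\<Union>w\<in>nbrs v. (#) v ` walks_from G w t)"
  then obtain w p' where "w \<in> nbrs v" "p = v # p'" "p' \<in> walks_from G w t" by auto
  with assms show "p \<in> walks_from G v (Suc t)"
    by (cases p') (auto simp: walks_from_def nbrs_def vwalk_def)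
qed

lemma finite_walks_from: "d > 0 \<Longrightarrow> v \<in> verts G \<Longrightarrow> finite (walks_from G v t)"
proof (induction t arbitrary: v)
  case 0
  then show ?case by (simp add: walks_from_0)
next
  case (Suc t)
  then show ?case by (auto simp: walks_from_Suc finite_nbrs nbrs_in_verts)
qed

lemma length_walks_from: "p \<in> walks_from G v t \<Longrightarrow> length p = Suc t"
  by (cases p) (auto simp: walks_from_def vwalk_def)

lemma hd_walks_from: "p \<in> walks_from G v t \<Longrightarrow> hd p = v"
  by (simp add: walks_from_def)

text \<open>Walks with different second vertices \<open>w\<close> are distinct. The predicate
  \<open>P\<close> makes one decomposition serve for all walks and for non-backtracking
  ones.\<close>

lemma sum_walks_from_Suc:
  assumes "d > 0" "v \<in> verts G"
  shows "(\<Sum>p \<in> {p \<in> walks_from G v (Suc t). P p}. f (last p))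
    = (\<Sum>w\<in>nbrs v. \<Sum>p \<in> {p \<in> walks_from G w t. P (v # p)}. f (last p))"
proof -
  have eq: "{p \<in> walks_from G v (Suc t). P p}
      = (\<Union>w\<in>nbrs v. (#) v ` {p \<in> walks_from G w t. P (v # p)})"
    using assms(2) by (auto simp: walks_from_Suc)
  have "(\<Sum>p \<in> {p \<in> walks_from G v (Suc t). P p}. f (last p))
      = (\<Sum>w\<in>nbrs v. \<Sum>p \<in> (#) v ` {p \<in> walks_from G w t. P (v # p)}. f (last p))"
    unfolding eq
    by (rule sum.UNION_disjoint)
       (auto simp: assms finite_nbrs finite_walks_from nbrs_in_verts dest: hd_walks_from)
  also have "\<dots> = (\<Sum>w\<in>nbrs v. \<Sum>p \<in> {p \<in> walks_from G w t. P (v # p)}. f (last p))"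
  proof (rule sum.cong[OF refl])
    fix w
    have "(\<Sum>p \<in> (#) v ` {p \<in> walks_from G w t. P (v # p)}. f (last p))
        = (\<Sum>p \<in> {p \<in> walks_from G w t. P (v # p)}. f (last (v # p)))"
      by (simp add: sum.reindex)
    also have "\<dots> = (\<Sum>p \<in> {p \<in> walks_from G w t. P (v # p)}. f (last p))"
      by (rule sum.cong) (auto dest: length_walks_from)
    finally show "(\<Sum>p \<in> (#) v ` {p \<in> walks_from G w t. P (v # p)}. f (last p)) = \<dots>" .
  qed
  finally show ?thesis .
qed

lemma walk_sum_Suc:
  assumes "d > 0" "v \<in> verts G"
  shows "walk_sum G v f (Suc t) = (\<Sum>w\<in>nbrs v. walk_sum G w f t)"
  using sum_walks_from_Suc[OF assms, where P = "\<lambda>_. True"] by (simp add: walk_sum_def)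

text \<open>The walks start at \<open>w\<close>, not at \<open>v\<close>; only their first step is prevented from leading to \<open>v\<close>.\<close>

definition avoid_sum :: "('a \<Rightarrow> real) \<Rightarrow> 'a \<Rightarrow> 'a \<Rightarrow> nat \<Rightarrow> real" where
  "avoid_sum f v w t = (\<Sum>p \<in> {p \<in> walks_from G w t. non_backtracking (v # p)}. f (last p))"

lemma nb_walk_sum_Suc:
  assumes "d > 0" "v \<in> verts G"
  shows "nb_walk_sum G v f (Suc t) = (\<Sum>w\<in>nbrs v. avoid_sum f v w t)"
  unfolding nb_walk_sum_def avoid_sum_def by (rule sum_walks_from_Suc[OF assms])

lemma avoid_sum_0: "w \<in> verts G \<Longrightarrow> avoid_sum f v w 0 = nb_walk_sum G w f 0"
  unfolding avoid_sum_def nb_walk_sum_def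
  by (intro sum.cong) (auto simp: walks_from_0 non_backtracking_def)

text \<open>The first step from \<open>w\<close> either avoids \<open>v\<close>, or leads to
  \<open>v\<close>, from where the walk must not return to \<open>w\<close> at once.\<close>

lemma nb_walk_sum_split:
  assumes "d > 0" "v \<in> nbrs w"
  shows "nb_walk_sum G w f (Suc t) = avoid_sum f v w (Suc t) + avoid_sum f w v t"
proof -
  have w: "w \<in> verts G" using assms nbrs_in_verts nbrs_sym by blast
  have "avoid_sum f v w (Suc t)
      = (\<Sum>u\<in>nbrs w. \<Sum>p \<in> {p \<in> walks_from G u t. non_backtracking (v # w # p)}. f (last p))"
    unfolding avoid_sum_def by (rule sum_walks_from_Suc[OF assms(1) w])
  also have "\<dots> = (\<Sum>u\<in>nbrs w. if u = v then 0 else avoid_sum f w u t)"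
  proof (rule sum.cong[OF refl])
    fix u assume "u \<in> nbrs w"
    have "{p \<in> walks_from G u t. non_backtracking (v # w # p)}
        = (if u = v then {} else {p \<in> walks_from G u t. non_backtracking (w # p)})"
    proof -
      have "non_backtracking (v # w # p) \<longleftrightarrow> non_backtracking (w # p) \<and> u \<noteq> v"
        if "p \<in> walks_from G u t" for p
        using length_walks_from[OF that] hd_walks_from[OF that]
        by (cases p) (auto simp: non_backtracking_Cons[of v])
      then show ?thesis by auto
    qed
    then show "(\<Sum>p \<in> {p \<in> walks_from G u t. non_backtracking (v # w # p)}. f (last p))
        = (if u = v then 0 else avoid_sum f w u t)"
      by (simp add: avoid_sum_def)
  qed
  finally have "avoid_sum f v w (Suc t) = \<dots>" .
  moreover have "(\<Sum>u\<in>nbrs w. avoid_sum f w u t)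
      = (\<Sum>u\<in>nbrs w. if u = v then 0 else avoid_sum f w u t) + avoid_sum f w v t"
    using assms finite_nbrs[OF assms(1) w]
    by (simp add: sum.remove[of "nbrs w" v])
  ultimately show ?thesis
    by (simp add: nb_walk_sum_Suc[OF assms(1) w])
qed

text \<open>
  Splitting by the first step twice gives
  \<open>\<Sum>\<^sub>w a\<^bsub>t+1\<^esub>(w) = a\<^bsub>t+2\<^esub>(v) + \<Sum>\<^sub>w avoid_sum f w v t\<close>, and splitting the last term once more leaves
  \<open>d * a\<^sub>t(v) - a\<^sub>t(v)\<close>.
\<close>

lemma sum_nbrs_nb_walk_sum:
  assumes "d = Suc q" "v \<in> verts G"
  shows "(\<Sum>w\<in>nbrs v. nb_walk_sum G w f t) = radial_step q (nb_walk_sum G v f) t"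
proof -
  have d: "d > 0" using assms by simp
  note [simp] = card_nbrs[OF assms(2)]
  show ?thesis
  proof (cases t)
    case 0
    then show ?thesis
      by (simp add: radial_step_def nb_walk_sum_Suc[OF d assms(2)] avoid_sum_0 nbrs_in_verts)
  next
    case (Suc s)
    have "(\<Sum>w\<in>nbrs v. nb_walk_sum G w f t)
        = (\<Sum>w\<in>nbrs v. avoid_sum f v w (Suc s) + avoid_sum f w v s)"
      unfolding Suc by (intro sum.cong refl nb_walk_sum_split[OF d]) (simp add: nbrs_sym)
    also have "\<dots> = nb_walk_sum G v f (Suc t) + (\<Sum>w\<in>nbrs v. avoid_sum f w v s)"
      by (simp add: sum.distrib nb_walk_sum_Suc[OF d assms(2)] Suc)
    finally have *: "(\<Sum>w\<in>nbrs v. nb_walk_sum G w f t) = \<dots>" .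
    show ?thesis
    proof (cases s)
      \<comment> \<open>The remaining walks have length \<open>0\<close>, so each neighbour
        contributes \<open>nb_walk_sum G v f 0\<close> in full and nothing is subtracted: the
        exceptional factor \<open>Suc q\<close>.\<close>
      case 0
      then show ?thesis
        using * assms by (simp add: Suc radial_step_def avoid_sum_0)
    next
      case (Suc u)
      have "(\<Sum>w\<in>nbrs v. avoid_sum f w v s)
          = (\<Sum>w\<in>nbrs v. nb_walk_sum G v f s - avoid_sum f v w u)"
        unfolding Suc by (intro sum.cong refl) (simp add: nb_walk_sum_split[OF d])
      also have "\<dots> = real d * nb_walk_sum G v f s - nb_walk_sum G v f s"
        by (simp add: sum_subtractf Suc nb_walk_sum_Suc[OF d assms(2)])
      finally show ?thesis
        using * assms Suc \<open>t = Suc s\<close> by (simp add: radial_step_def algebra_simps)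
    qed
  qed
qed

text \<open>The first step replaces \<open>v\<close> by its neighbours, hence the induction over all
  starting vertices. By linearity the sum over the neighbours becomes a \<open>radial_step\<close>,
  which amounts to one more unit of time.\<close>

lemma walk_sum_eq_walk_transform:
  assumes "d = Suc q" "v \<in> verts G"
  shows "walk_sum G v f t = walk_transform q (nb_walk_sum G v f) t"
  using assms(2)
proof (induction t arbitrary: v)
  case 0
  have "{p \<in> walks_from G v 0. non_backtracking p} = {[v]}"
    using 0 by (auto simp: walks_from_0 non_backtracking_def)
  then show ?case
    using 0 by (simp add: walk_transform_def walk_sum_def nb_walk_sum_def walks_from_0)
next
  case (Suc t)
  have "walk_sum G v f (Suc t) = (\<Sum>w\<in>nbrs v. walk_transform q (nb_walk_sum G w f) t)"
    using Suc assms by (simp add: walk_sum_Suc nbrs_in_verts)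
  also have "\<dots> = walk_transform q (\<lambda>k. \<Sum>w\<in>nbrs v. nb_walk_sum G w f k) t"
    by (simp add: walk_transform_sum)
  also have "\<dots> = walk_transform q (nb_walk_sum G v f) (Suc t)"
    by (simp add: walk_transform_Suc sum_nbrs_nb_walk_sum[OF assms(1) Suc.prems])
  finally show ?case .
qed

section \<open>Geodesics and positive spherical sums\<close>

lemma walk_from_to:
  assumes "u \<in> verts G" "v \<in> verts G"
  obtains p where "vwalk p G" "hd p = u" "last p = v"
proof -
  have "(u, v) \<in> (arcs_ends G)\<^sup>*"
    using connected assms by (auto simp: strongly_connected_def reachable_conv)
  then have "\<exists>p. vwalk p G \<and> hd p = u \<and> last p = v"
    using assms(2)
  proof (induction rule: converse_rtrancl_induct)
    case base
    then show ?case by (intro exI[of _ "[v]"]) (auto simp: vwalk_def)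
  next
    case (step y z)
    then obtain p where "vwalk p G" "hd p = z" "last p = v" by blast
    with step show ?case
      by (intro exI[of _ "y # p"]) (auto simp: vwalk_def adj_in_verts)
  qed
  with that show ?thesis by blast
qed

text \<open>A piece \<open>a, b, a\<close> could be shortened to \<open>a\<close>, giving a walk
  with the same ends and two steps fewer.\<close>

lemma geodesic_non_backtracking:
  assumes "vwalk p G" "hd p = u" "last p = v" "vwalk_length p = graph_dist G u v"
  shows "non_backtracking p"
  unfolding non_backtracking_def
proof (intro allI impI notI)
  fix i assume i: "i + 2 < length p" and eq: "p ! i = p ! (i + 2)"
  define xs a b ys where defs: "xs = take i p" "a = p ! i" "b = p ! (i + 1)" "ys = drop (i + 3) p"
  have p: "p = xs @ a # b # a # ys"
    using i eq id_take_nth_drop[of i p] Cons_nth_drop_Suc[of "i + 1" p] Cons_nth_drop_Suc[of "i + 2" p]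
    unfolding defs by (simp add: numeral_3_eq_3)
  let ?p = "xs @ a # ys"
  have "vwalk ?p G"
    using assms(1) unfolding p vwalk_def by (cases "xs = []"; cases ys) (auto simp: vwalk_arcs_append)
  moreover have "hd ?p = u" "last ?p = v"
    using assms(2,3) unfolding p by (cases xs; cases ys; simp)+
  ultimately have "graph_dist G u v \<le> vwalk_length ?p"
    unfolding graph_dist_def by (intro Least_le) blast
  then show False
    using assms(4) unfolding p by simp
qed

text \<open>A geodesic to \<open>v\<close> is among the summed walks. The positive level has the
  parity that separates \<open>even_verts\<close> from \<open>odd_verts\<close>.\<close>

lemma nb_walk_sum_pos_at_dist:
  assumes "d > 0" "r \<in> verts G" "v \<in> verts G" "f v \<noteq> 0" "\<forall>v \<in> verts G. f v \<ge> 0"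
  shows "nb_walk_sum G r f (graph_dist G r v) > 0"
proof -
  have "\<exists>n p. vwalk p G \<and> hd p = r \<and> last p = v \<and> vwalk_length p = n"
    using walk_from_to[OF assms(2,3)] by metis
  from LeastI_ex[OF this] obtain p
    where p: "vwalk p G" "hd p = r" "last p = v" "vwalk_length p = graph_dist G r v"
    unfolding graph_dist_def by blast
  let ?A = "{p \<in> walks_from G r (graph_dist G r v). non_backtracking p}"
  have "p \<in> ?A"
    using p geodesic_non_backtracking by (auto simp: walks_from_def)
  moreover have "f (last p') \<ge> 0" if "p' \<in> ?A" for p'
    using that assms(5) last_in_set by (fastforce simp: walks_from_def vwalk_def)
  moreover have "finite ?A" using finite_walks_from assms by simp
  moreover have "f (last p) > 0" using assms(3-5) unfolding p(3) by (metis order_le_less)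
  ultimately show ?thesis
    unfolding nb_walk_sum_def by (intro sum_pos2[of ?A p "\<lambda>p. f (last p)"])
qed

lemma nb_walk_sum_nonneg:
  assumes "\<forall>v \<in> verts G. f v \<ge> 0"
  shows "nb_walk_sum G r f t \<ge> 0"
  unfolding nb_walk_sum_def
  by (rule sum_nonneg) (use assms last_in_set in \<open>fastforce simp: walks_from_def vwalk_def\<close>)

end

section \<open>Bounds on walk counts\<close>

text \<open>The transform of the eigensequence \<open>\<phi>\<close> is exactly
  \<open>(x + y) ^ t * \<phi> 0\<close>. As \<open>\<phi>\<close> dominates \<open>c * x ^ k\<close>
  with \<open>c = \<phi> 0\<close>, no constant is left in the bound.\<close>

lemma walk_transform_le_power:
  fixes x y :: real
  assumes "0 < y" "y < x" "x * y = real q" "q \<ge> 1"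
  shows "walk_transform q (\<lambda>k. x ^ k) t \<le> (x + y) ^ t"
proof -
  \<comment> \<open>the eigensequence: the combination of \<open>x\<^sup>k\<close> and \<open>y\<^sup>k\<close> forced by the two exceptional steps at \<open>k = 0, 1\<close>\<close>
  define \<phi> where "\<phi> k = (if k = 0 then real q * (x - y)
    else (real q * x - y) * x ^ k + (x - real q * y) * y ^ k)" for k :: nat
  have step: "radial_step q \<phi> k = (x + y) * \<phi> k" for k
  proof -
    consider "k = 0" | "k = 1" | j where "k = Suc (Suc j)"
      by (metis One_nat_def not0_implies_Suc)
    then show ?thesis
    proof cases
      case 1
      then show ?thesis by (simp add: radial_step_def \<phi>_def assms(3)[symmetric] algebra_simps)
    next
      case 2
      then show ?thesis
        by (simp add: radial_step_def \<phi>_def assms(3)[symmetric] algebra_simps power2_eq_square)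
    next
      case 3
      then show ?thesis
        by (simp add: radial_step_def \<phi>_def assms(3)[symmetric] algebra_simps)
    qed
  qed
  have eigen: "walk_transform q \<phi> t = (x + y) ^ t * \<phi> 0" for t
  proof (induction t)
    case 0
    then show ?case by (simp add: walk_transform_def)
  next
    case (Suc t)
    have "walk_transform q \<phi> (Suc t) = walk_transform q (\<lambda>k. (x + y) * \<phi> k) t"
      by (simp add: walk_transform_Suc step[abs_def])
    also have "\<dots> = (x + y) * walk_transform q \<phi> t"
      by (simp add: walk_transform_def sum_distrib_left mult_ac)
    finally show ?case by (simp add: Suc)
  qed
  define c where "c = real q * (x - y)"
  have c: "c > 0" using assms by (simp add: c_def)
  have q: "y \<le> real q * y" "x \<le> real q * x" using assms by simp_all
  have lower: "c * x ^ k \<le> \<phi> k" for k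
  proof (cases "k = 0")
    case False
    have xk: "0 \<le> x ^ k" "0 \<le> y ^ k" "y ^ k \<le> x ^ k" using assms by (auto intro: power_mono)
    show ?thesis
    \<comment> \<open>A nonnegative coefficient of \<open>y ^ k\<close> is dropped. A negative one
      is charged to \<open>x ^ k\<close>, where the coefficients add up to
      \<open>(q + 1) * (x - y)\<close>, which is at least \<open>c\<close>.\<close>
    proof (cases "x \<ge> real q * y")
      case True
      have "c * x ^ k \<le> (real q * x - y) * x ^ k"
        using q xk by (intro mult_right_mono) (auto simp: c_def algebra_simps)
      also have "\<dots> \<le> \<phi> k" using True False xk by (simp add: \<phi>_def)
      finally show ?thesis .
    next
      case False
      have "c * x ^ k \<le> ((real q * x - y) + (x - real q * y)) * x ^ k"
        using assms xk by (intro mult_right_mono) (auto simp: c_def algebra_simps)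
      also have "\<dots> \<le> \<phi> k"
        using False \<open>k \<noteq> 0\<close> mult_left_mono_neg[OF xk(3), of "x - real q * y"]
        by (simp add: \<phi>_def distrib_right)
      finally show ?thesis .
    qed
  qed (simp add: \<phi>_def c_def)
  have "c * walk_transform q (\<lambda>k. x ^ k) t = walk_transform q (\<lambda>k. c * x ^ k) t"
    by (simp add: walk_transform_def sum_distrib_left mult_ac)
  also have "\<dots> \<le> walk_transform q \<phi> t" by (rule walk_transform_mono) (rule lower)
  also have "\<dots> = c * (x + y) ^ t" by (simp add: eigen \<phi>_def c_def)
  finally show ?thesis using c by simp
qed

text \<open>For \<open>2 * j \<le> t\<close>, the number of paths with \<open>t - j\<close> up-steps
  and \<open>j\<close> down-steps that never go below their start. It is real-valued to avoid
  truncated subtraction.\<close>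

definition ballot :: "nat \<Rightarrow> nat \<Rightarrow> real" where
  "ballot t j = real (t choose j) - (if j = 0 then 0 else real (t choose (j - 1)))"

lemma ballot_Suc_Suc: "ballot (Suc t) (Suc j) = ballot t (Suc j) + ballot t j"
  by (cases j) (simp_all add: ballot_def)

text \<open>\<open>q ^ j * ballot t j\<close> follows the recursion of \<open>walk_count\<close>,
  except that at \<open>k = 0\<close> the factor is \<open>q\<close> in place of
  \<open>Suc q\<close>; hence only an inequality.\<close>

lemma walk_count_ge_ballot:
  "real q ^ j * ballot (k + 2 * j) j \<le> real (walk_count q (k + 2 * j) k)"
proof -
  have "t = k + 2 * j \<Longrightarrow> real q ^ j * ballot t j \<le> real (walk_count q t k)" for t
  proof (induction t arbitrary: k j)
    case 0
    then show ?case by (simp add: ballot_def)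
  next
    case (Suc t)
    show ?case
    proof (cases k)
      case 0
      with Suc.prems obtain i where j: "j = Suc i" and t: "t = 1 + 2 * i" by (cases j) auto
      \<comment> \<open>The two middle coefficients of the odd row \<open>t = 2 * i + 1\<close>
        agree, so level \<open>-1\<close> contributes nothing.\<close>
      have "t choose Suc i = t choose i"
        using binomial_symmetric[of i t] t by simp
      then have "ballot t (Suc i) = 0"
        by (simp add: ballot_def)
      then have "real q ^ j * ballot (Suc t) j = real q * (real q ^ i * ballot t i)"
        by (simp add: j ballot_Suc_Suc)
      also have "\<dots> \<le> real q * real (walk_count q t 1)"
        by (intro mult_left_mono Suc.IH) (simp_all add: t)
      also have "\<dots> \<le> real (walk_count q (Suc t) k)"
        by (simp add: 0)
      finally show ?thesis .
    next
      case k: (Suc k')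
      show ?thesis
      proof (cases j)
        case 0
        then have "walk_count q t k' \<ge> 1"
          using Suc.IH[of k' 0] Suc.prems k by (simp add: ballot_def)
        then have "walk_count q (Suc t) k \<ge> 1" by (simp add: k)
        then show ?thesis using 0 by (simp add: ballot_def)
      next
        case j: (Suc i)
        have "real q ^ j * ballot t j \<le> real (walk_count q t k')"
          using Suc.prems k j by (intro Suc.IH) simp
        moreover have "real q * (real q ^ i * ballot t i) \<le> real q * real (walk_count q t (Suc (Suc k')))"
          using Suc.prems k j by (intro mult_left_mono Suc.IH) simp_all
        ultimately show ?thesis
          by (simp add: j k ballot_Suc_Suc distrib_left mult.assoc)
      qed
    qed
  qed
  then show ?thesis by simp
qed

text \<open>By the ballot theorem the quotient of \<open>ballot t j\<close> by
  \<open>t choose j\<close>, for \<open>t = k + 2 * j\<close>, is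
  \<open>(k + 1) / (k + j + 1)\<close>, which is at least \<open>1 / (t + 1)\<close>.\<close>

lemma ballot_ge: "real ((k + 2 * j) choose j) / real (Suc (k + 2 * j)) \<le> ballot (k + 2 * j) j"
proof (cases j)
  case 0
  then show ?thesis by (simp add: ballot_def)
next
  case (Suc i)
  define t where "t = k + 2 * j"
  have "(t - i) * (t choose i) = Suc i * (t choose Suc i)"
    by (metis binomial_absorb_comp binomial_absorption)
  then have "real (t - i) * real (t choose i) = real (Suc i) * real (t choose Suc i)"
    by (simp only: of_nat_mult[symmetric])
  moreover have "t - i = k + i + 2" by (simp add: t_def Suc)
  ultimately have "real (k + i + 2) * real (t choose i) = real (Suc i) * real (t choose Suc i)"
    by simp
  then have "real (k + i + 2) * ballot t j = real (Suc k) * real (t choose j)"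
    by (simp add: ballot_def Suc algebra_simps)
  then have "ballot t j = real (Suc k) / real (k + i + 2) * real (t choose j)"
    by (simp add: field_simps)
  moreover have "1 / real (Suc t) \<le> real (Suc k) / real (k + i + 2)"
    by (intro frac_le) (auto simp: t_def Suc)
  then have "1 / real (Suc t) * real (t choose j) \<le> real (Suc k) / real (k + i + 2) * real (t choose j)"
    by (rule mult_right_mono) simp
  ultimately show ?thesis by (simp add: t_def)
qed

lemma walk_count_ge_binomial:
  "real q ^ j * real ((k + 2 * j) choose j) / real (Suc (k + 2 * j)) \<le> real (walk_count q (k + 2 * j) k)"
proof -
  have "real q ^ j * (real ((k + 2 * j) choose j) / real (Suc (k + 2 * j))) \<le> real q ^ j * ballot (k + 2 * j) j"
    by (intro mult_left_mono ballot_ge) simp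
  with walk_count_ge_ballot[of q j k] show ?thesis by simp
qed

text \<open>For \<open>i < t\<close> the term of index \<open>i + 1\<close> is at least that of
  index \<open>i\<close> iff \<open>(i + 1) * (x + y) \<le> (t + 1) * y\<close>. So the terms rise
  up to index \<open>j\<close> and fall afterwards, and there are \<open>t + 1\<close> of
  them.\<close>

lemma binomial_mode:
  fixes x y :: real and t :: nat
  assumes "0 < y" "0 < x"
  defines "j \<equiv> nat \<lfloor>real (Suc t) * y / (x + y)\<rfloor>"
  shows "(x + y) ^ t \<le> real (Suc t) * (real (t choose j) * x ^ (t - j) * y ^ j)"
proof -
  define T where "T i = real (t choose i) * x ^ (t - i) * y ^ i" for i
  have T0: "T i \<ge> 0" for i using assms by (simp add: T_def)
  have ratio: "real (Suc i) * x * T (Suc i) = real (t - i) * y * T i" if "i < t" for i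
  proof -
    have "(t - i) * (t choose i) = Suc i * (t choose Suc i)"
      by (metis binomial_absorb_comp binomial_absorption)
    then have *: "real (t - i) * real (t choose i) = real (Suc i) * real (t choose Suc i)"
      by (simp only: of_nat_mult[symmetric])
    have "x * x ^ (t - Suc i) = x ^ (t - i)"
      using that by (metis Suc_diff_Suc power_Suc)
    then have "real (Suc i) * x * T (Suc i) = (real (Suc i) * real (t choose Suc i)) * x ^ (t - i) * y ^ Suc i"
      unfolding T_def by (simp add: mult_ac)
    also have "\<dots> = real (t - i) * y * T i"
      unfolding *[symmetric] T_def by simp
    finally show ?thesis .
  qed
  have j: "real j \<le> real (Suc t) * y / (x + y)" "real (Suc t) * y / (x + y) < real (Suc j)"
    using assms by (auto simp: j_def) linarith+
  have up: "T i \<le> T (Suc i)" if "i < j" "i < t" for i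
  proof -
    have "real (Suc i) \<le> real (Suc t) * y / (x + y)" using j(1) that by simp
    then have "real (Suc i) * x \<le> real (t - i) * y"
      using assms that by (simp add: field_simps of_nat_diff)
    then have "real (Suc i) * x * T i \<le> real (Suc i) * x * T (Suc i)"
      unfolding ratio[OF that(2)] by (rule mult_right_mono) (rule T0)
    then show ?thesis using assms by simp
  qed
  have down: "T (Suc i) \<le> T i" if "j \<le> i" "i < t" for i
  proof -
    have "real (Suc t) * y / (x + y) < real (Suc i)" using j(2) that by simp
    then have "real (t - i) * y \<le> real (Suc i) * x"
      using assms that by (simp add: field_simps of_nat_diff)
    then have "real (Suc i) * x * T (Suc i) \<le> real (Suc i) * x * T i"
      unfolding ratio[OF that(2)] by (rule mult_right_mono) (rule T0)
    then show ?thesis using assms by simp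
  qed
  have "real (Suc t) * y / (x + y) < real (Suc t)"
    using assms(1,2) by (subst pos_divide_less_eq) (auto simp del: of_nat_Suc)
  with j have "j \<le> t" by linarith
  have max: "T i \<le> T j" if "i \<le> t" for i
  proof (cases "i \<le> j")
    case True
    then show ?thesis
    proof (induction rule: inc_induct)
      case (step n)
      then show ?case using up[of n] \<open>j \<le> t\<close> by simp
    qed simp
  next
    case False
    then have "j \<le> i" by simp
    then show ?thesis using that
    proof (induction rule: dec_induct)
      case (step n)
      then show ?case using down[of n] by simp
    qed simp
  qed
  have "(x + y) ^ t = (\<Sum>i\<le>t. T i)"
    using binomial_ring[of y x t] by (simp add: T_def add.commute mult_ac)
  also have "\<dots> \<le> (\<Sum>i\<le>t. T j)" by (rule sum_mono) (simp add: max)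
  finally show ?thesis by (simp add: T_def)
qed

section \<open>Roots of powers with constant and polynomial factors\<close>

lemma root_power_bound:
  fixes M l y :: real
  assumes "M > 0" "l > 0" "l < y"
  shows "\<forall>\<^sub>F t in sequentially. root t (M * l ^ t) < y"
proof -
  have "(\<lambda>t. root t M * l) \<longlonglongrightarrow> 1 * l"
    by (intro tendsto_intros LIMSEQ_root_const assms)
  then have "\<forall>\<^sub>F t in sequentially. root t M * l < y"
    using assms by (intro order_tendstoD(2)) auto
  then show ?thesis
    using eventually_gt_at_top[of 0]
  proof eventually_elim
    case (elim t)
    then show ?case using assms by (simp add: real_root_mult real_root_power_cancel)
  qed
qed

lemma root_power_div_square_bound:
  fixes c l y :: real
  assumes "c > 0" "l > 0" "y < l"
  shows "\<forall>\<^sub>F t in sequentially. y < root t (c * l ^ t / (real t)\<^sup>2)"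
proof -
  have "(\<lambda>t. root t c * l / (root t (real t))\<^sup>2) \<longlonglongrightarrow> 1 * l / 1\<^sup>2"
    by (intro tendsto_intros LIMSEQ_root_const LIMSEQ_root assms) simp
  then have "\<forall>\<^sub>F t in sequentially. y < root t c * l / (root t (real t))\<^sup>2"
    using assms by (intro order_tendstoD(1)) auto
  then show ?thesis
    using eventually_gt_at_top[of 0]
  proof eventually_elim
    case (elim t)
    then show ?case
      using assms by (simp add: real_root_mult real_root_divide real_root_power_cancel real_root_power)
  qed
qed

text \<open>Discrete intermediate value theorem: unit steps cannot skip a level between
  \<open>0\<close> and a later large value.\<close>

lemma surj_of_unit_steps:
  fixes \<kappa> :: "nat \<Rightarrow> nat"
  assumes "\<kappa> 0 = 0" "\<And>t. \<bar>int (\<kappa> (Suc t)) - int (\<kappa> t)\<bar> \<le> 1" "filterlim \<kappa> at_top sequentially"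
  shows "surj \<kappa>"
proof -
  have "\<exists>t. \<kappa> t = k" for k
  proof -
    obtain n where "k \<le> \<kappa> n"
      using assms(3) by (metis eventually_sequentially filterlim_at_top order_refl)
    then have "\<exists>i\<le>n. int (\<kappa> i) = int k"
      using assms by (intro nat0_intermed_int_val) auto
    then show ?thesis by auto
  qed
  then show ?thesis by (metis surjI)
qed

lemma walk_transform_ge_single:
  assumes "\<And>k. 0 \<le> a k" "k \<le> t"
  shows "real (walk_count q t k) * a k \<le> walk_transform q a t"
  unfolding walk_transform_def
  using assms by (intro member_le_sum[of k "{..t}" "\<lambda>k. real (walk_count q t k) * a k"]) auto

text \<open>
  The level \<open>\<kappa> t = t - 2j\<close>, with \<open>j\<close> the mode of the binomial expansion of \<open>(x + y)\<^sup>t\<close>, is the one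
  that contributes most to \<open>b\<^sub>t\<close>. It has the parity of \<open>t\<close>, moves by one when \<open>t\<close> does and tends
  to infinity because \<open>y < x\<close>.
\<close>

lemma saddle_levels:
  fixes x y :: real
  assumes "0 < y" "y < x" "x * y = real q"
  obtains \<kappa> :: "nat \<Rightarrow> nat"
  where "surj \<kappa>" "filterlim \<kappa> at_top sequentially"
    "\<And>t. \<kappa> t \<le> t" "\<And>t. even (\<kappa> t) = even t"
    "\<And>t a. (\<And>k. 0 \<le> a k) \<Longrightarrow> x ^ \<kappa> t \<le> a (\<kappa> t) \<Longrightarrow>
       (x + y) ^ t / (real (Suc t))\<^sup>2 \<le> walk_transform q a t"
proof -
  define p where "p = y / (x + y)"
  have p: "0 < p" "p < 1 / 2" using assms by (auto simp: p_def field_simps)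
  define j where "j t = nat \<lfloor>real (Suc t) * p\<rfloor>" for t
  have j: "real (j t) \<le> real (Suc t) * p" "real (Suc t) * p < real (Suc (j t))" for t
    using p by (auto simp: j_def) linarith+
  have j2: "2 * j t \<le> t" for t
  proof -
    have "real (Suc t) * p < real (Suc t) * (1 / 2)"
      using p by (intro mult_strict_left_mono) auto
    with j(1)[of t] have "real (j t) < real (Suc t) * (1 / 2)" by (rule le_less_trans)
    then show ?thesis by simp
  qed
  \<comment> \<open>Since \<open>0 < p < 1\<close>, the mode advances by \<open>0\<close> or
    \<open>1\<close>, so \<open>t - 2 * j t\<close> changes by exactly one.\<close>
  have jS: "j (Suc t) = j t \<or> j (Suc t) = Suc (j t)" for t
  proof -
    have "real (j t) < real (Suc (j (Suc t)))" "real (j (Suc t)) < real (Suc (Suc (j t)))"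
      using j[of t] j[of "Suc t"] p by (auto simp: distrib_right)
    then show ?thesis by linarith
  qed
  define \<kappa> where "\<kappa> t = t - 2 * j t" for t
  have \<kappa>: "t = \<kappa> t + 2 * j t" for t using j2[of t] by (simp add: \<kappa>_def)
  have lim: "filterlim \<kappa> at_top sequentially"
  proof -
    have 1: "filterlim (\<lambda>t. -1 + (1 - 2 * p) * real t) at_top sequentially"
      by (rule filterlim_tendsto_add_at_top[OF tendsto_const
            filterlim_tendsto_pos_mult_at_top[OF tendsto_const _ filterlim_real_sequentially]])
         (use p in simp)
    have 2: "-1 + (1 - 2 * p) * real t \<le> real (\<kappa> t)" for t
    proof -
      have "real (\<kappa> t) = real t - 2 * real (j t)" using \<kappa>[of t] by linarith
      then show ?thesis using j(1)[of t] p by (simp add: algebra_simps)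
    qed
    have "filterlim (\<lambda>t. real (\<kappa> t)) at_top sequentially"
      by (rule filterlim_at_top_mono[OF 1 always_eventually[OF allI[OF 2]]])
    then show ?thesis by (simp add: filterlim_sequentially_iff_filterlim_real)
  qed
  moreover have "surj \<kappa>"
  proof (rule surj_of_unit_steps[OF _ _ lim])
    show "\<bar>int (\<kappa> (Suc t)) - int (\<kappa> t)\<bar> \<le> 1" for t
      using jS[of t] \<kappa>[of t] \<kappa>[of "Suc t"] by linarith
  qed (simp add: \<kappa>_def)
  moreover have "(x + y) ^ t / (real (Suc t))\<^sup>2 \<le> walk_transform q a t"
    if a: "\<And>k. 0 \<le> a k" "x ^ \<kappa> t \<le> a (\<kappa> t)" for t a
  proof -
    have "(x + y) ^ t \<le> real (Suc t) * (real (t choose j t) * x ^ (t - j t) * y ^ j t)"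
      using binomial_mode[of y x t] assms by (simp add: j_def p_def)
    then have "(x + y) ^ t / (real (Suc t))\<^sup>2
        \<le> real (Suc t) * (real (t choose j t) * x ^ (t - j t) * y ^ j t) / (real (Suc t))\<^sup>2"
      by (rule divide_right_mono) simp
    also have "\<dots> = real (t choose j t) * x ^ (t - j t) * y ^ j t / real (Suc t)"
      by (simp add: power2_eq_square)
    also have "t - j t = \<kappa> t + j t" using \<kappa>[of t] by linarith
    \<comment> \<open>Substituting \<open>q = x * y\<close> gives
      \<open>x ^ (\<kappa> t + j t) * y ^ j t = q ^ j t * x ^ \<kappa> t\<close>; the factor in
      front of \<open>x ^ \<kappa> t\<close> is then the lower bound for the walk count.\<close>
    also have "real (t choose j t) * x ^ (\<kappa> t + j t) * y ^ j t / real (Suc t)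
        = (real q ^ j t * real (t choose j t) / real (Suc t)) * x ^ \<kappa> t"
      by (simp add: power_add assms(3)[symmetric] power_mult_distrib mult_ac)
    also have "\<dots> \<le> real (walk_count q t (\<kappa> t)) * a (\<kappa> t)"
      using walk_count_ge_binomial[of q "j t" "\<kappa> t"] assms a unfolding \<kappa>[of t, symmetric]
      by (intro mult_mono) auto
    also have "\<dots> \<le> walk_transform q a t"
      using a by (intro walk_transform_ge_single) (auto simp: \<kappa>_def)
    finally show ?thesis .
  qed
  moreover have "\<kappa> t \<le> t" "even (\<kappa> t) = even t" for t
    using \<kappa>[of t] by (simp add: \<kappa>_def, metis even_add even_mult_iff even_numeral)
  ultimately show ?thesis using that by blast
qed

section \<open>Growth rates\<close>

text \<open>Both branches have the form \<open>m + q / m\<close> with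
  \<open>m = max x (sqrt q)\<close>, as \<open>q / sqrt q = sqrt q\<close>. The upper bound can thus
  be proved without distinguishing them.\<close>

lemma g_fun_eq:
  assumes "q \<ge> 1" "0 \<le> x"
  shows "g_fun (Suc q) x = max x (sqrt (real q)) + real q / max x (sqrt (real q))"
  using assms by (auto simp: g_fun_def max_def real_div_sqrt)

lemma eventually_range_strict_mono:
  fixes h :: "nat \<Rightarrow> nat"
  assumes "strict_mono h" "\<forall>\<^sub>F n in sequentially. P (h n)"
  shows "\<forall>\<^sub>F k in sequentially. k \<in> range h \<longrightarrow> P k"
proof -
  obtain N where N: "\<And>n. n \<ge> N \<Longrightarrow> P (h n)"
    using assms(2) by (auto simp: eventually_sequentially)
  show ?thesis
    unfolding eventually_sequentially
    using N strict_mono_less_eq[OF assms(1)] by (intro exI[of _ "h N"]) auto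
qed

text \<open>\<open>h\<close> is meant for \<open>t\<close>, \<open>2 * t\<close> or
  \<open>2 * t + 1\<close>: along with an index its range contains all of the same parity, and only
  these levels enter \<open>walk_transform q a (h n)\<close>.\<close>

lemma root_walk_transform_upper:
  fixes h :: "nat \<Rightarrow> nat"
  assumes q: "q \<ge> 1" and a: "\<And>k. 0 \<le> a k"
    and h: "strict_mono h" "\<And>n k. even k = even (h n) \<Longrightarrow> k \<in> range h"
    and \<alpha>: "0 \<le> \<alpha>" "\<And>x. \<alpha> < x \<Longrightarrow> \<forall>\<^sub>F n in sequentially. root (h n) (a (h n)) < x"
    and y: "g_fun (Suc q) \<alpha> < y"
  shows "\<forall>\<^sub>F n in sequentially. root (h n) (walk_transform q a (h n)) < y"
proof -
  define \<mu> where "\<mu> = max \<alpha> (sqrt (real q))"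
  have \<mu>: "\<mu> > 0" using q by (simp add: \<mu>_def less_max_iff_disj)
  \<comment> \<open>The bound for powers needs \<open>x > sqrt q\<close>, so that
    \<open>q / x < x\<close>. A point just to the right of \<open>\<mu>\<close> satisfies this and
    keeps \<open>x + q / x\<close> below \<open>y\<close>.\<close>
  have "((\<lambda>x. x + real q / x) \<longlongrightarrow> \<mu> + real q / \<mu>) (at_right \<mu>)"
    using \<mu> by (intro tendsto_intros) auto
  then have "\<forall>\<^sub>F x in at_right \<mu>. x + real q / x < y"
    using y by (intro order_tendstoD(2)) (auto simp: g_fun_eq[OF q \<alpha>(1)] \<mu>_def)
  moreover have "\<forall>\<^sub>F x in at_right \<mu>. \<mu> < x" by (rule eventually_at_right_less)
  ultimately have "\<forall>\<^sub>F x in at_right \<mu>. \<mu> < x \<and> x + real q / x < y"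
    by eventually_elim simp
  then obtain x where x: "\<mu> < x" "x + real q / x < y"
    using eventually_happens trivial_limit_at_right_real by blast
  have x0: "x > 0" "\<alpha> < x" "sqrt (real q) < x" using x \<mu> by (auto simp: \<mu>_def)
  have "real q / x < x"
    using x0 real_less_lsqrt[of "real q" x] by (simp add: pos_divide_less_eq power2_eq_square)
       (metis abs_of_pos linorder_not_less real_sqrt_abs2 real_sqrt_le_mono)
  then have pow: "walk_transform q (\<lambda>k. x ^ k) t \<le> (x + real q / x) ^ t" for t
    using q x0 by (intro walk_transform_le_power) auto
  have "\<forall>\<^sub>F k in sequentially. k \<in> range h \<longrightarrow> root k (a k) < x"
    using eventually_range_strict_mono[OF h(1) \<alpha>(2)[OF x0(2)]] .
  then obtain N where N: "\<And>k. k \<ge> N \<Longrightarrow> k \<in> range h \<Longrightarrow> root k (a k) < x"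
    by (auto simp: eventually_sequentially)
  \<comment> \<open>The sum takes care of the finitely many levels up to \<open>N\<close>, the
    summand \<open>1\<close> of those beyond.\<close>
  define M where "M = 1 + (\<Sum>k\<le>N. a k / x ^ k)"
  have S: "0 \<le> (\<Sum>k\<le>N. a k / x ^ k)" using a x0 by (intro sum_nonneg) simp
  have M: "M \<ge> 1" using S by (simp add: M_def)
  have aM: "a k \<le> M * x ^ k" if "k \<in> range h" for k
  proof (cases "k \<le> N")
    case True
    have "a k / x ^ k \<le> (\<Sum>k\<le>N. a k / x ^ k)"
      using True a x0 by (intro member_le_sum[of k "{..N}" "\<lambda>k. a k / x ^ k"]) auto
    then have "a k / x ^ k \<le> M" by (simp add: M_def)
    then show ?thesis using x0 by (simp add: pos_divide_le_eq)
  next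
    case False
    then have "root k (a k) \<le> x" "k > 0" using N[of k] that by auto
    then have "root k (a k) ^ k \<le> x ^ k" using a by (intro power_mono) auto
    then have "a k \<le> x ^ k" using \<open>k > 0\<close> a by simp
    also have "\<dots> \<le> M * x ^ k" using M x0 by simp
    finally show ?thesis .
  qed
  have bound: "walk_transform q a (h n) \<le> M * (x + real q / x) ^ h n" for n
  proof -
    have "walk_transform q a (h n) \<le> walk_transform q (\<lambda>k. M * x ^ k) (h n)"
      by (intro walk_transform_mono aM h(2))
    also have "\<dots> = M * walk_transform q (\<lambda>k. x ^ k) (h n)"
      by (simp add: walk_transform_def sum_distrib_left mult_ac)
    also have "\<dots> \<le> M * (x + real q / x) ^ h n"
      using M pow by (intro mult_left_mono) auto
    finally show ?thesis .
  qed
  have "\<forall>\<^sub>F t in sequentially. root t (M * (x + real q / x) ^ t) < y"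
    using M x x0 by (intro root_power_bound) (auto intro: add_pos_nonneg)
  then have "\<forall>\<^sub>F n in sequentially. root (h n) (M * (x + real q / x) ^ h n) < y"
    by (rule eventually_compose_filterlim[OF _ filterlim_subseq[OF h(1)]])
  moreover have "\<forall>\<^sub>F n in sequentially. 0 < h n"
    using filterlim_subseq[OF h(1)] eventually_gt_at_top[of 0] by (rule eventually_compose_filterlim[rotated])
  ultimately show ?thesis
  proof eventually_elim
    case (elim n)
    then show ?case using real_root_le_mono[OF elim(2) bound[of n]] by linarith
  qed
qed

text \<open>Go straight to the target at distance \<open>k\<close>, then follow a closed walk of
  length \<open>t\<close> there.\<close>

lemma walk_count_add: "walk_count q t 0 \<le> walk_count q (t + k) k"
  by (induction k) (simp_all add: trans_le_add1)

text \<open>By the central binomial coefficient there are at least \<open>(4 * q) ^ n\<close> closed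
  walks of length \<open>2 * n\<close>, up to a polynomial factor. Another \<open>k\<close> steps
  reach a level where \<open>a\<close> is positive, at times of the parity of
  \<open>k\<close>.\<close>

lemma root_walk_transform_lower_bulk:
  assumes q: "q \<ge> 1" and a: "\<And>k. 0 \<le> a k" "0 < a k"
    and y: "y < 2 * sqrt (real q)"
  shows "\<forall>\<^sub>F t in sequentially. even t = even k \<longrightarrow> y < root t (walk_transform q a t)"
proof -
  define l where "l = 2 * sqrt (real q)"
  have l: "l > 0" "l\<^sup>2 = 4 * real q" using q by (simp_all add: l_def power_mult_distrib)
  \<comment> \<open>\<open>l ^ k\<close> compensates for the \<open>k\<close> steps outside the
    closed walk; the \<open>4\<close> comes from
    \<open>2 * n * (2 * n + 1) \<le> 4 * t ^ 2\<close>.\<close>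
  define c where "c = a k / (4 * l ^ k)"
  have c: "c > 0" using a l by (simp add: c_def)
  have bound: "c * l ^ t / (real t)\<^sup>2 \<le> walk_transform q a t" if "k < t" "even t = even k" for t
  proof -
    from that have "even (t - k)" by simp
    then obtain n where "t - k = 2 * n" by blast
    with that have n: "t = 2 * n + k" "n > 0" by auto
    have "l ^ (2 * n) / (4 * (real t)\<^sup>2) = real q ^ n * 4 ^ n / (4 * (real t)\<^sup>2)"
      by (simp add: power_mult l power_mult_distrib)
    also have "\<dots> \<le> real q ^ n * 4 ^ n / (2 * real n * real (Suc (2 * n)))"
    proof (rule divide_left_mono)
      have "real n * (1 + 2 * real n) \<le> real t * (2 * real t)"
        using n by (intro mult_mono) auto
      then show "2 * real n * real (Suc (2 * n)) \<le> 4 * (real t)\<^sup>2"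
        by (simp add: power2_eq_square)
    qed (use n in auto)
    also have "\<dots> = real q ^ n * (4 ^ n / (2 * real n)) / real (Suc (2 * n))" by simp
    also have "\<dots> \<le> real q ^ n * real (2 * n choose n) / real (Suc (2 * n))"
      using central_binomial_lower_bound[OF n(2)] by (intro divide_right_mono mult_left_mono) auto
    also have "\<dots> \<le> real (walk_count q (2 * n) 0)"
      using walk_count_ge_binomial[of q n 0] by simp
    also have "\<dots> \<le> real (walk_count q t k)"
      using walk_count_add n by simp
    finally have "l ^ (2 * n) / (4 * (real t)\<^sup>2) * a k \<le> real (walk_count q t k) * a k"
      using a by (intro mult_right_mono) auto
    also have "\<dots> \<le> walk_transform q a t"
      using a(1) that by (intro walk_transform_ge_single) auto
    finally show ?thesis
      using l by (simp add: c_def n power_add mult_ac)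
  qed
  have "\<forall>\<^sub>F t in sequentially. y < root t (c * l ^ t / (real t)\<^sup>2)"
    using c l y by (intro root_power_div_square_bound) (auto simp: l_def)
  then show ?thesis
    using eventually_gt_at_top[of k]
  proof eventually_elim
    case (elim t)
    then show ?case
      using real_root_le_mono[OF _ bound[of t], of t] by (auto intro: less_le_trans)
  qed
qed

text \<open>By continuity \<open>x\<close> can be taken just below \<open>\<alpha>\<close>. The
  condition \<open>x ^ \<kappa> t \<le> a (\<kappa> t)\<close> stays in the conclusion: under a
  limit it holds at all large levels concerned, under a limsup it is used by contraposition.\<close>

lemma root_walk_transform_lower_saddle:
  assumes q: "q \<ge> 1" and a: "\<And>k. 0 \<le> a k"
    and \<alpha>: "sqrt (real q) < \<alpha>" and y: "y < \<alpha> + real q / \<alpha>"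
  obtains x :: real and \<kappa> :: "nat \<Rightarrow> nat"
  where "0 < x" "x < \<alpha>" "surj \<kappa>" "filterlim \<kappa> at_top sequentially"
    "\<forall>t. \<kappa> t \<le> t \<and> even (\<kappa> t) = even t"
    "\<forall>\<^sub>F t in sequentially. x ^ \<kappa> t \<le> a (\<kappa> t) \<longrightarrow> y < root t (walk_transform q a t)"
proof -
  have "\<alpha> > 0" using \<alpha> real_sqrt_ge_zero[of "real q"] by linarith
  then have "((\<lambda>x. x + real q / x) \<longlongrightarrow> \<alpha> + real q / \<alpha>) (at_left \<alpha>)"
    by (intro tendsto_intros) auto
  then have "\<forall>\<^sub>F x in at_left \<alpha>. y < x + real q / x"
    using y by (rule order_tendstoD)
  moreover have "\<forall>\<^sub>F x in at_left \<alpha>. x \<in> {sqrt (real q)<..<\<alpha>}"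
    by (rule eventually_at_left_real[OF \<alpha>])
  ultimately have "\<forall>\<^sub>F x in at_left \<alpha>. y < x + real q / x \<and> x \<in> {sqrt (real q)<..<\<alpha>}"
    by (rule eventually_conj)
  then obtain x where x: "sqrt (real q) < x" "x < \<alpha>" "y < x + real q / x"
    using eventually_happens trivial_limit_at_left_real by fastforce
  have x0: "x > 0" using x real_sqrt_ge_zero[of "real q"] by linarith
  have "real q < x * x"
    using x x0 by (metis real_sqrt_less_iff real_sqrt_abs2 abs_of_pos)
  then have "real q / x < x" using x0 by (simp add: pos_divide_less_eq)
  then obtain \<kappa> where \<kappa>: "surj \<kappa>" "filterlim \<kappa> at_top sequentially"
      "\<And>t. \<kappa> t \<le> t" "\<And>t. even (\<kappa> t) = even t"
      "\<And>t a. (\<And>k. 0 \<le> a k) \<Longrightarrow> x ^ \<kappa> t \<le> a (\<kappa> t) \<Longrightarrow>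
         (x + real q / x) ^ t / (real (Suc t))\<^sup>2 \<le> walk_transform q a t"
    using saddle_levels[of "real q / x" x q] q x0 by auto
  have "\<forall>\<^sub>F t in sequentially. y < root t (1 / 4 * (x + real q / x) ^ t / (real t)\<^sup>2)"
    using x x0 by (intro root_power_div_square_bound) (auto intro: add_pos_nonneg)
  then have "\<forall>\<^sub>F t in sequentially. x ^ \<kappa> t \<le> a (\<kappa> t) \<longrightarrow> y < root t (walk_transform q a t)"
    using eventually_gt_at_top[of 0]
  proof eventually_elim
    case (elim t)
    show ?case
    proof
      assume "x ^ \<kappa> t \<le> a (\<kappa> t)"
      then have *: "(x + real q / x) ^ t / (real (Suc t))\<^sup>2 \<le> walk_transform q a t"
        using a by (intro \<kappa>(5))
      have "(real (Suc t))\<^sup>2 \<le> (2 * real t)\<^sup>2"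
        using elim(2) by (intro power_mono) auto
      then have "(x + real q / x) ^ t / (2 * real t)\<^sup>2 \<le> (x + real q / x) ^ t / (real (Suc t))\<^sup>2"
        using x0 elim(2) by (intro divide_left_mono) auto
      with * have "1 / 4 * (x + real q / x) ^ t / (real t)\<^sup>2 \<le> walk_transform q a t"
        by (simp add: power_mult_distrib)
      with elim show "y < root t (walk_transform q a t)"
        using real_root_le_mono by (meson less_le_trans)
    qed
  qed
  with that[of x \<kappa>] x x0 \<kappa> show ?thesis by blast
qed

text \<open>If \<open>a\<close> vanished on a parity met by \<open>h\<close>, so would
  \<open>walk_transform q a\<close>, and the lower bound \<open>2 * sqrt q\<close> would fail there;
  the positive levels exclude this.\<close>

lemma tendsto_root_walk_transform:
  fixes h :: "nat \<Rightarrow> nat"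
  assumes q: "q \<ge> 1" and a: "\<And>k. 0 \<le> a k"
    and h: "strict_mono h" "\<And>n k. even k = even (h n) \<Longrightarrow> k \<in> range h"
    and pos: "\<And>n. \<exists>k. even k = even (h n) \<and> 0 < a k"
    and lim: "(\<lambda>n. root (h n) (a (h n))) \<longlonglongrightarrow> \<alpha>"
  shows "(\<lambda>n. root (h n) (walk_transform q a (h n))) \<longlonglongrightarrow> g_fun (Suc q) \<alpha>"
proof (rule order_tendstoI)
  have \<alpha>: "0 \<le> \<alpha>"
    using lim by (rule LIMSEQ_le_const) (use a real_root_ge_zero in auto)
  show "\<forall>\<^sub>F n in sequentially. root (h n) (walk_transform q a (h n)) < y"
    if "g_fun (Suc q) \<alpha> < y" for y
    using root_walk_transform_upper[of q a h \<alpha> y] q a h \<alpha> that order_tendstoD(2)[OF lim] by blast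
  fix y assume y: "y < g_fun (Suc q) \<alpha>"
  have "\<forall>\<^sub>F t in sequentially. t \<in> range h \<longrightarrow> y < root t (walk_transform q a t)"
  proof (cases "\<alpha> \<le> sqrt (real q)")
    case True
    then have y: "y < 2 * sqrt (real q)" using y by (simp add: g_fun_def)
    have "\<forall>\<^sub>F t in sequentially. t \<in> range h \<and> even t = b \<longrightarrow> y < root t (walk_transform q a t)" for b
    proof (cases "\<exists>n. even (h n) = b")
      case True
      then obtain k where k: "even k = b" "0 < a k" using pos by metis
      have "\<forall>\<^sub>F t in sequentially. even t = even k \<longrightarrow> y < root t (walk_transform q a t)"
        by (rule root_walk_transform_lower_bulk) (use q a k y in auto)
      then show ?thesis by eventually_elim (use k in auto)
    qed (auto intro: always_eventually)
    from this[of True] this[of False] show ?thesis by eventually_elim auto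
  next
    case False
    then have \<alpha>': "sqrt (real q) < \<alpha>" and y: "y < \<alpha> + real q / \<alpha>"
      using y by (auto simp: g_fun_def)
    obtain x \<kappa> where x: "0 < x" "x < \<alpha>" "surj \<kappa>" "filterlim \<kappa> at_top sequentially"
        "\<forall>t. \<kappa> t \<le> t \<and> even (\<kappa> t) = even t"
        "\<forall>\<^sub>F t in sequentially. x ^ \<kappa> t \<le> a (\<kappa> t) \<longrightarrow> y < root t (walk_transform q a t)"
      by (rule root_walk_transform_lower_saddle[where a = a, OF q a \<alpha>' y])
    have "\<forall>\<^sub>F k in sequentially. k \<in> range h \<longrightarrow> x < root k (a k)"
      using eventually_range_strict_mono[OF h(1) order_tendstoD(1)[OF lim x(2)]] .
    then have "\<forall>\<^sub>F k in sequentially. k \<in> range h \<longrightarrow> x ^ k \<le> a k"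
      using eventually_gt_at_top[of 0]
    proof eventually_elim
      case (elim k)
      show ?case
      proof
        assume "k \<in> range h"
        then have "x ^ k \<le> root k (a k) ^ k" using elim x by (intro power_mono) auto
        then show "x ^ k \<le> a k" using a elim by simp
      qed
    qed
    then have "\<forall>\<^sub>F t in sequentially. \<kappa> t \<in> range h \<longrightarrow> x ^ \<kappa> t \<le> a (\<kappa> t)"
      by (rule eventually_compose_filterlim[OF _ x(4)])
    with x(6) show ?thesis
    proof eventually_elim
      case (elim t)
      \<comment> \<open>\<open>\<kappa> t\<close> has the parity of \<open>t\<close>, so it lies in
        the range of \<open>h\<close> when \<open>t\<close> does.\<close>
      then show ?case using h(2) x(5)[rule_format, of t] by blast
    qed
  qed
  from eventually_compose_filterlim[OF this filterlim_subseq[OF h(1)]]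
  show "\<forall>\<^sub>F n in sequentially. y < root (h n) (walk_transform q a (h n))" by simp
qed

text \<open>Suppose the limsup on the left were too small. If \<open>\<alpha> > sqrt q\<close>, the
  saddle condition fails for all large \<open>t\<close>; surjectivity of \<open>\<kappa>\<close>
  then yields \<open>a k < x ^ k\<close> at all large levels, although \<open>x < \<alpha>\<close>.
  Otherwise one positive level suffices, since times of a single parity already bound a limsup from
  below.\<close>

lemma limsup_root_walk_transform:
  assumes q: "q \<ge> 1" and a: "\<And>k. 0 \<le> a k" "0 < a k"
    and lim: "limsup (\<lambda>t. ereal (root t (a t))) = ereal \<alpha>" and \<alpha>: "0 \<le> \<alpha>"
  shows "limsup (\<lambda>t. ereal (root t (walk_transform q a t))) = ereal (g_fun (Suc q) \<alpha>)"
    (is "limsup ?b = _")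
proof (rule antisym)
  show "limsup ?b \<le> ereal (g_fun (Suc q) \<alpha>)"
    unfolding Limsup_le_iff
  proof (intro allI impI)
    fix z assume z: "ereal (g_fun (Suc q) \<alpha>) < z"
    show "\<forall>\<^sub>F t in sequentially. ?b t < z"
    proof (cases z)
      case (real y)
      have "\<forall>\<^sub>F t in sequentially. root t (a t) < x" if "\<alpha> < x" for x
        using Limsup_lessD[of sequentially "\<lambda>t. ereal (root t (a t))" "ereal x"] lim that by simp
      then have "\<forall>\<^sub>F t in sequentially. root t (walk_transform q a t) < y"
        using root_walk_transform_upper[of q a "\<lambda>t. t" \<alpha> y] q a \<alpha> z real
        by (simp add: strict_mono_def)
      then show ?thesis by (simp add: real)
    qed (use z in auto)
  qed
next
  show "ereal (g_fun (Suc q) \<alpha>) \<le> limsup ?b"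
  proof (rule ccontr)
    assume "\<not> ?thesis"
    then obtain y where y: "limsup ?b < ereal y" "ereal y < ereal (g_fun (Suc q) \<alpha>)"
      using ereal_dense2[of "limsup ?b" "ereal (g_fun (Suc q) \<alpha>)"] by (auto simp: not_le)
    have less: "\<forall>\<^sub>F t in sequentially. root t (walk_transform q a t) < y"
      using Limsup_lessD[OF y(1)] by simp
    show False
    proof (cases "\<alpha> \<le> sqrt (real q)")
      case True
      then have "y < 2 * sqrt (real q)" using y(2) by (simp add: g_fun_def)
      then have "\<forall>\<^sub>F t in sequentially. even t = even k \<longrightarrow> y < root t (walk_transform q a t)"
        by (intro root_walk_transform_lower_bulk q a)
      from this less
      have "\<forall>\<^sub>F t in sequentially. even t \<noteq> even k"
        by eventually_elim auto
      then obtain N :: nat where "\<And>t. t \<ge> N \<Longrightarrow> even t \<noteq> even k"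
        by (auto simp: eventually_sequentially)
      from this[of "k + 2 * N"] show False by simp
    next
      case False
      then have \<alpha>': "sqrt (real q) < \<alpha>" and y': "y < \<alpha> + real q / \<alpha>"
        using y(2) by (auto simp: g_fun_def)
      obtain x \<kappa> where x: "0 < x" "x < \<alpha>" "surj \<kappa>" "filterlim \<kappa> at_top sequentially"
          "\<forall>t. \<kappa> t \<le> t \<and> even (\<kappa> t) = even t"
          "\<forall>\<^sub>F t in sequentially. x ^ \<kappa> t \<le> a (\<kappa> t) \<longrightarrow> y < root t (walk_transform q a t)"
        by (rule root_walk_transform_lower_saddle[where a = a, OF q a(1) \<alpha>' y'])
      from x(6) less have "\<forall>\<^sub>F t in sequentially. \<not> x ^ \<kappa> t \<le> a (\<kappa> t)"
        by eventually_elim auto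
      then obtain N where N: "\<And>t. t \<ge> N \<Longrightarrow> a (\<kappa> t) < x ^ \<kappa> t"
        by (auto simp: eventually_sequentially not_le)
      \<comment> \<open>Because \<open>\<kappa> t \<le> t\<close>, a level
        \<open>k = \<kappa> t\<close> beyond \<open>N\<close> can only come from a time beyond
        \<open>N\<close>.\<close>
      have "ereal (root k (a k)) \<le> ereal x" if "k \<ge> Suc N" for k
      proof -
        obtain t where t: "k = \<kappa> t" using x(3) by (metis surjD)
        with N[of t] x(5)[rule_format, of t] that have "a k < x ^ k" by simp
        then have "root k (a k) \<le> root k (x ^ k)"
          using that by (intro real_root_le_mono) auto
        then show ?thesis using that x(1) by (simp add: real_root_power_cancel)
      qed
      then have "limsup (\<lambda>t. ereal (root t (a t))) \<le> ereal x"
        by (intro Limsup_bounded) (auto simp: eventually_sequentially)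
      with lim x(2) show False by simp
    qed
  qed
qed

theorem theorem2p1:
  fixes G :: "('a, 'b) pre_digraph" and d :: nat and r :: 'a and f :: "'a \<Rightarrow> real"
  assumes "d \<ge> 3"
    and "regular_tree d G"
    and "r \<in> verts G"
    and "\<forall>v \<in> verts G. f v \<ge> 0"
    and "\<exists>v \<in> verts G. f v \<noteq> 0"
    and "nb_growth G r f < \<infinity>"
  shows "walk_growth G r f = ereal (g_fun d (real_of_ereal (nb_growth G r f)))
    \<and> (convergent (\<lambda>t. root t (nb_walk_sum G r f t))
         \<and> (\<exists>v \<in> even_verts G r. f v \<noteq> 0) \<and> (\<exists>v \<in> odd_verts G r. f v \<noteq> 0)
       \<longrightarrow> convergent (\<lambda>t. root t (walk_sum G r f t))
         \<and> lim (\<lambda>t. root t (walk_sum G r f t)) = g_fun d (lim (\<lambda>t. root t (nb_walk_sum G r f t))))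
    \<and> (convergent (\<lambda>t. root (2 * t) (nb_walk_sum G r f (2 * t)))
         \<and> (\<exists>v \<in> even_verts G r. f v \<noteq> 0)
       \<longrightarrow> convergent (\<lambda>t. root (2 * t) (walk_sum G r f (2 * t)))
         \<and> lim (\<lambda>t. root (2 * t) (walk_sum G r f (2 * t)))
           = g_fun d (lim (\<lambda>t. root (2 * t) (nb_walk_sum G r f (2 * t)))))
    \<and> (convergent (\<lambda>t. root (2 * t + 1) (nb_walk_sum G r f (2 * t + 1)))
         \<and> (\<exists>v \<in> odd_verts G r. f v \<noteq> 0)
       \<longrightarrow> convergent (\<lambda>t. root (2 * t + 1) (walk_sum G r f (2 * t + 1)))
         \<and> lim (\<lambda>t. root (2 * t + 1) (walk_sum G r f (2 * t + 1)))
           = g_fun d (lim (\<lambda>t. root (2 * t + 1) (nb_walk_sum G r f (2 * t + 1)))))"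
proof -
  interpret regular_tree d G by fact
  obtain q where d: "d = Suc q" and q: "q \<ge> 1"
    using assms(1) by (cases d) auto
  define a where "a = nb_walk_sum G r f"
  have nonneg: "0 \<le> a k" for k
    unfolding a_def by (rule nb_walk_sum_nonneg[OF assms(4)])
  have walk_sum: "walk_sum G r f = walk_transform q a"
    unfolding a_def using walk_sum_eq_walk_transform[OF d assms(3)] by blast
  have pos: "0 < a (graph_dist G r v)" if "v \<in> verts G" "f v \<noteq> 0" for v
    unfolding a_def using nb_walk_sum_pos_at_dist assms(1,3,4) that by simp
  have even_pos: "\<exists>k. even k \<and> 0 < a k" if "\<exists>v \<in> even_verts G r. f v \<noteq> 0"
    using that pos by (auto simp: even_verts_def)
  have odd_pos: "\<exists>k. odd k \<and> 0 < a k" if "\<exists>v \<in> odd_verts G r. f v \<noteq> 0"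
    using that pos by (auto simp: odd_verts_def)
  have limit: "convergent (\<lambda>n. root (h n) (walk_transform q a (h n)))
      \<and> lim (\<lambda>n. root (h n) (walk_transform q a (h n))) = g_fun d (lim (\<lambda>n. root (h n) (a (h n))))"
    if "convergent (\<lambda>n. root (h n) (a (h n)))" "strict_mono h"
      "\<And>n k. even k = even (h n) \<Longrightarrow> k \<in> range h" "\<And>n. \<exists>k. even k = even (h n) \<and> 0 < a k"
    for h :: "nat \<Rightarrow> nat"
  proof -
    have "(\<lambda>n. root (h n) (walk_transform q a (h n))) \<longlonglongrightarrow> g_fun d (lim (\<lambda>n. root (h n) (a (h n))))"
      unfolding d
      by (rule tendsto_root_walk_transform[OF q nonneg that(2,3,4)])
         (use that(1) in \<open>simp_all add: convergent_LIMSEQ_iff\<close>)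
    then show ?thesis by (auto simp: convergent_def limI)
  qed
  \<comment> \<open>Together with the assumed finiteness this makes the growth a real number, so
    \<open>real_of_ereal\<close> does not fall back to its value \<open>0\<close> at
    infinity.\<close>
  have "0 \<le> nb_growth G r f"
    unfolding nb_growth_def by (rule le_Limsup) (use nonneg in \<open>simp_all add: a_def real_root_ge_zero\<close>)
  with assms(6) obtain \<alpha> where \<alpha>: "nb_growth G r f = ereal \<alpha>" "0 \<le> \<alpha>"
    by (cases "nb_growth G r f") auto
  obtain v where "v \<in> verts G" "f v \<noteq> 0" using assms(5) by blast
  then have "0 < a (graph_dist G r v)" by (rule pos)
  then have "limsup (\<lambda>t. ereal (root t (walk_transform q a t))) = ereal (g_fun (Suc q) \<alpha>)"
    by (intro limsup_root_walk_transform[where k = "graph_dist G r v"] q nonneg)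
       (use \<alpha> in \<open>simp_all add: nb_growth_def a_def\<close>)
  then have "walk_growth G r f = ereal (g_fun d (real_of_ereal (nb_growth G r f)))"
    by (simp add: walk_growth_def walk_sum d \<alpha>)
  moreover have "convergent (\<lambda>t. root t (walk_sum G r f t))
         \<and> lim (\<lambda>t. root t (walk_sum G r f t)) = g_fun d (lim (\<lambda>t. root t (a t)))"
    if "convergent (\<lambda>t. root t (a t))" "\<exists>v \<in> even_verts G r. f v \<noteq> 0" "\<exists>v \<in> odd_verts G r. f v \<noteq> 0"
    unfolding walk_sum using that(1)
    by (rule limit[of "\<lambda>t. t"]) (use even_pos[OF that(2)] odd_pos[OF that(3)] in \<open>auto simp: strict_mono_def\<close>)
  moreover have "convergent (\<lambda>t. root (2 * t) (walk_sum G r f (2 * t)))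
         \<and> lim (\<lambda>t. root (2 * t) (walk_sum G r f (2 * t))) = g_fun d (lim (\<lambda>t. root (2 * t) (a (2 * t))))"
    if "convergent (\<lambda>t. root (2 * t) (a (2 * t)))" "\<exists>v \<in> even_verts G r. f v \<noteq> 0"
    unfolding walk_sum using that(1)
    by (rule limit[of "\<lambda>t. 2 * t"]) (use even_pos[OF that(2)] in \<open>auto simp: strict_mono_def elim!: evenE\<close>)
  moreover have "convergent (\<lambda>t. root (2 * t + 1) (walk_sum G r f (2 * t + 1)))
         \<and> lim (\<lambda>t. root (2 * t + 1) (walk_sum G r f (2 * t + 1)))
           = g_fun d (lim (\<lambda>t. root (2 * t + 1) (a (2 * t + 1))))"
    if "convergent (\<lambda>t. root (2 * t + 1) (a (2 * t + 1)))" "\<exists>v \<in> odd_verts G r. f v \<noteq> 0"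
    unfolding walk_sum using that(1)
    by (rule limit[of "\<lambda>t. 2 * t + 1"])
       (use odd_pos[OF that(2)] in \<open>auto simp: strict_mono_def elim!: oddE\<close>)
  ultimately show ?thesis unfolding a_def by blast
qed

end
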